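(* Let $E$ be a finitely irreducible infinite countable set (with respect to a matrix $A:E\times E\to\{0,1\}$). Let $F\subset E$ be a finitely irreducible subset of $E$ and let $\Lambda$ be a nonempty set witnessing finite irreducibility for $F$. Let $\alpha>0$. Then for every $a\in E$ and every $\alpha$-Hölder function $f:E_A^{\mathbb N}\to\mathbb R$ such that $P_F^\sigma(f)\ge0$, $$e^{P^\sigma_{F\cup\{a\}}(f)}\le e^{P^\sigma_F(f)}+\frac{\sharp\Lambda\,e^{L(f)}}{\kappa_\Lambda(f)}\,e^{p_\Lambda P_F^\sigma(f)}\,e^{\sup f|_{[a]}}.$$
   Context: $\mathbb N=\{1,2,\dots\}$. $E$ is a countable alphabet and $A:E\times E\to\{0,1\}$ a matrix. For $F\subset E$: $F_A^n$ ($n\ge1$) is the set of words $\omega\in F^n$ with $A_{\omega_k\omega_{k+1}}=1$ for $1\le k\le n-1$; $F_A^0=\{\emptyset\}$ (empty word); $F_A^*=\bigcup_{n\ge0}F_A^n$; $F_A^{\mathbb N}$ is the set of $\omega\in F^{\mathbb N}$ with $A_{\omega_k\omega_{k+1}}=1$ for all $k$. $|\omega|$ is the length of a finite word. $\sigma:E_A^{\mathbb N}\to E_A^{\mathbb N}$ is the left shift. For $\omega\in E_A^*$, $[\omega]=\{\tau\in E_A^{\mathbb N}:\tau|_{|\omega|}=\omega\}$, and for $\omega\in F_A^*$, $[\omega]_F=\{\tau\in F_A^{\mathbb N}:\tau|_{|\omega|}=\omega\}$. $\omega\wedge\tau$ is the longest common initial block of $\omega,\tau$. A finite set $\Lambda\subset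 F_A^*$ witnesses finite irreducibility for $F$ if for all $i,j\in F$ there is $\omega\in\Lambda$ with $i\omega j\in F_A^*$; $F$ is finitely irreducible if such a $\Lambda$ exists (likewise for $F=E$). $\sharp\Lambda$ is the cardinality of $\Lambda$, and $p_\Lambda=\max_{\lambda\in\Lambda}|\lambda|$. $f:E_A^{\mathbb N}\to\mathbb R$ is $\alpha$-Hölder if $\sup_{n\ge1}\sup\{|f(\omega)-f(\tau)|e^{\alpha(n-1)}:\omega,\tau\in E_A^{\mathbb N},\ |\omega\wedge\tau|\ge n\}<\infty$. $S_nf=\sum_{j=0}^{n-1}f\circ\sigma^j$ (so $S_0f=0$). Topological pressure: $Z_n(F,f)=\sum_{\omega\in F_A^n}\exp\left(\sup_{\tau\in[\omega]_F}S_nf(\tau)\right)$ (a term with $[\omega]_F=\emptyset$ being $0$), and $P_F^\sigma(f)=\lim_{n\to\infty}\frac1n\log Z_n(F,f)=\inf_n\frac1n\log Z_n(F,f)\in[-\infty,+\infty]$. $L(f)$ is the infimum of all $M>0$ such that $|S_nf(\rho\omega)-S_nf(\rho\tau)|\le M$ for all $n\in\mathbb N$, $\rho\in E_A^n$, $\omega,\tau\in E_A^{\mathbb N}$ with $\rho\omega,\rho\tau\in E_A^{\mathbb N}$ (finite for Hölder $f$). $\kappa_\Lambda(f)=\min_{\lambda\in\Lambda}\inf_{[\lambda]}e^{S_{|\lambda|}f}$. *)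

theory Defs
  imports "HOL-Analysis.Analysis" "HOL-Library.Stream"
begin

text \<open>
  An alphabet is a set \<open>E\<close> of elements of an arbitrary type and the matrix is a function
  \<open>A\<close> with values in \<open>{0, 1}\<close> on \<open>E\<close>. Finite words are lists, infinite words are streams, indexed
  from 0. Functions on the shift space are total functions on streams; only their values on
  \<open>inf_words A E\<close> matter.
\<close>

definition words :: "('a \<Rightarrow> 'a \<Rightarrow> nat) \<Rightarrow> 'a set \<Rightarrow> nat \<Rightarrow> 'a list set" where
  "words A F n = {\<omega>. length \<omega> = n \<and> set \<omega> \<subseteq> F \<and>
     (\<forall>k. Suc k < n \<longrightarrow> A (\<omega> ! k) (\<omega> ! Suc k) = 1)}"

definition fin_words :: "('a \<Rightarrow> 'a \<Rightarrow> nat) \<Rightarrow> 'a set \<Rightarrow> 'a list set" where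
  "fin_words A F = (\<Union>n. words A F n)"

definition inf_words :: "('a \<Rightarrow> 'a \<Rightarrow> nat) \<Rightarrow> 'a set \<Rightarrow> 'a stream set" where
  "inf_words A F = {\<omega>. \<forall>k. \<omega> !! k \<in> F \<and> A (\<omega> !! k) (\<omega> !! Suc k) = 1}"

definition cylinder :: "('a \<Rightarrow> 'a \<Rightarrow> nat) \<Rightarrow> 'a set \<Rightarrow> 'a list \<Rightarrow> 'a stream set" where
  "cylinder A F \<omega> = {\<tau> \<in> inf_words A F. stake (length \<omega>) \<tau> = \<omega>}"

text \<open>The length of the longest common initial block of two infinite words.\<close>

definition common_length :: "'a stream \<Rightarrow> 'a stream \<Rightarrow> enat" where
  "common_length \<omega> \<tau> = (SUP n \<in> {n. stake n \<omega> = stake n \<tau>}. enat n)"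

definition witnesses_irreducibility ::
  "('a \<Rightarrow> 'a \<Rightarrow> nat) \<Rightarrow> 'a set \<Rightarrow> 'a list set \<Rightarrow> bool" where
  "witnesses_irreducibility A F \<Lambda> \<longleftrightarrow> finite \<Lambda> \<and> \<Lambda> \<subseteq> fin_words A F \<and>
     (\<forall>i\<in>F. \<forall>j\<in>F. \<exists>\<omega>\<in>\<Lambda>. [i] @ \<omega> @ [j] \<in> fin_words A F)"

definition finitely_irreducible :: "('a \<Rightarrow> 'a \<Rightarrow> nat) \<Rightarrow> 'a set \<Rightarrow> bool" where
  "finitely_irreducible A F \<longleftrightarrow> (\<exists>\<Lambda>. witnesses_irreducibility A F \<Lambda>)"

text \<open>The supremum is taken in the extended reals, so that its finiteness is a real condition.\<close>

definition Holder ::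
  "('a \<Rightarrow> 'a \<Rightarrow> nat) \<Rightarrow> 'a set \<Rightarrow> real \<Rightarrow> ('a stream \<Rightarrow> real) \<Rightarrow> bool" where
  "Holder A E \<alpha> f \<longleftrightarrow>
     (SUP n \<in> {1..}. Sup {ereal (\<bar>f \<omega> - f \<tau>\<bar> * exp (\<alpha> * (real n - 1))) | \<omega> \<tau>.
        \<omega> \<in> inf_words A E \<and> \<tau> \<in> inf_words A E \<and> common_length \<omega> \<tau> \<ge> enat n}) < \<infinity>"

definition birkhoff_sum :: "('a stream \<Rightarrow> real) \<Rightarrow> nat \<Rightarrow> 'a stream \<Rightarrow> real" where
  "birkhoff_sum f n \<tau> = (\<Sum>j<n. f (sdrop j \<tau>))"

text \<open>Exponential and logarithm between \<open>[-\<infinity>, \<infinity>]\<close> and \<open>[0, \<infinity>]\<close>.\<close>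

definition eexp :: "ereal \<Rightarrow> ennreal" where
  "eexp x = (if x = -\<infinity> then 0 else if x = \<infinity> then \<infinity> else ennreal (exp (real_of_ereal x)))"

definition elog :: "ennreal \<Rightarrow> ereal" where
  "elog x = (if x = 0 then -\<infinity> else if x = \<infinity> then \<infinity> else ereal (ln (enn2real x)))"

text \<open>
  Words with empty cylinder contribute 0 to the partition function, since the supremum of the
  empty set of extended reals is \<open>-\<infinity>\<close>.
\<close>

definition partition_function ::
  "('a \<Rightarrow> 'a \<Rightarrow> nat) \<Rightarrow> 'a set \<Rightarrow> ('a stream \<Rightarrow> real) \<Rightarrow> nat \<Rightarrow> ennreal" where
  "partition_function A F f n =
     (\<Sum>\<^sub>\<infinity>\<omega>\<in>words A F n. eexp (SUP \<tau>\<in>cylinder A F \<omega>. ereal (birkhoff_sum f n \<tau>)))"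

definition pressure ::
  "('a \<Rightarrow> 'a \<Rightarrow> nat) \<Rightarrow> 'a set \<Rightarrow> ('a stream \<Rightarrow> real) \<Rightarrow> ereal" where
  "pressure A F f = lim (\<lambda>n. ereal (1 / real n) * elog (partition_function A F f n))"

definition distortion ::
  "('a \<Rightarrow> 'a \<Rightarrow> nat) \<Rightarrow> 'a set \<Rightarrow> ('a stream \<Rightarrow> real) \<Rightarrow> real" where
  "distortion A E f = Inf {M. M > 0 \<and>
     (\<forall>n\<ge>1. \<forall>\<rho>\<in>words A E n. \<forall>\<omega>\<in>inf_words A E. \<forall>\<tau>\<in>inf_words A E.
        \<rho> @- \<omega> \<in> inf_words A E \<longrightarrow> \<rho> @- \<tau> \<in> inf_words A E \<longrightarrow>
        \<bar>birkhoff_sum f n (\<rho> @- \<omega>) - birkhoff_sum f n (\<rho> @- \<tau>)\<bar> \<le> M)}"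

text \<open>The cylinders here are those of the full alphabet \<open>E\<close>, even if \<open>\<Lambda>\<close> witnesses finite
  irreducibility for a subset of \<open>E\<close>.\<close>

definition kappa ::
  "('a \<Rightarrow> 'a \<Rightarrow> nat) \<Rightarrow> 'a set \<Rightarrow> 'a list set \<Rightarrow> ('a stream \<Rightarrow> real) \<Rightarrow> real" where
  "kappa A E \<Lambda> f =
     Min ((\<lambda>\<omega>. INF \<tau>\<in>cylinder A E \<omega>. exp (birkhoff_sum f (length \<omega>) \<tau>)) ` \<Lambda>)"

definition max_length :: "'a list set \<Rightarrow> nat" where
  "max_length \<Lambda> = Max (length ` \<Lambda>)"

end

theory Submission
  imports Defs
begin

text \<open>
  Write \<open>Z\<^sub>n\<close> for the partition function of \<open>F\<close>, \<open>W\<^sub>n\<close> for the larger sum over the same words in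
  which the suprema are taken over the cylinders of \<open>E\<close>, and let \<open>P\<close> be the pressure of \<open>F\<close>, \<open>L\<close> the
  distortion and \<open>p\<close> the maximal length in \<open>\<Lambda>\<close>. Joining a word of length \<open>n\<close> to a word of length
  \<open>N \<ge> 1\<close> by an element of \<open>\<Lambda>\<close> gives
  \<open>\<kappa> exp (-L) W\<^sub>n Z\<^sub>N \<le> (\<Sum>\<mu>\<in>\<Lambda>. Z\<^bsub>n+|\<mu>|+N\<^esub>)\<close>. Multiplying by \<open>exp (-tN)\<close> with \<open>t > P\<close>, taking the supremum
  over \<open>N\<close> (it is finite and positive, hence cancels) and letting \<open>t\<close> tend to \<open>P\<close> yields
  \<open>W\<^sub>n \<le> K exp (nP)\<close> for all \<open>n \<ge> 0\<close>, where \<open>K = |\<Lambda>| exp (L + pP) / \<kappa>\<close>; this uses \<open>P \<ge> 0\<close>.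
  Splitting a word over \<open>F \<union> {a}\<close> at its first \<open>a\<close> gives
  \<open>V\<^sub>n \<le> W\<^sub>n + (\<Sum>k<n. W\<^sub>k s V\<^bsub>n-1-k\<^esub>)\<close> for the corresponding sums \<open>V\<^sub>n\<close>, with \<open>s\<close> the supremum of \<open>exp f\<close>
  on \<open>[a]\<close>, and by induction \<open>V\<^sub>n \<le> K (exp P + K s)\<^sup>n\<close>.
\<close>

lemma infsum_ennreal_eq_SUP:
  fixes f :: "'b \<Rightarrow> ennreal"
  shows "infsum f A = (SUP X\<in>{X. finite X \<and> X \<subseteq> A}. sum f X)"
  by (rule nonneg_infsum_complete) simp

lemma summable_on_ennreal':
  fixes f :: "'b \<Rightarrow> ennreal"
  shows "f summable_on A"
  by (rule nonneg_summable_on_complete) simp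

lemma infsum_ennreal_least:
  fixes f :: "'b \<Rightarrow> ennreal"
  assumes "\<And>X. finite X \<Longrightarrow> X \<subseteq> A \<Longrightarrow> sum f X \<le> c"
  shows "infsum f A \<le> c"
  unfolding infsum_ennreal_eq_SUP using assms by (intro SUP_least) auto

lemma sum_le_infsum_ennreal:
  fixes f :: "'b \<Rightarrow> ennreal"
  assumes "finite X" "X \<subseteq> A"
  shows "sum f X \<le> infsum f A"
  unfolding infsum_ennreal_eq_SUP using assms by (intro SUP_upper) auto

lemma infsum_ennreal_mono:
  fixes f g :: "'b \<Rightarrow> ennreal"
  assumes "\<And>x. x \<in> A \<Longrightarrow> f x \<le> g x"
  shows "infsum f A \<le> infsum g A"
  using assms by (intro infsum_mono summable_on_ennreal') auto

lemma infsum_ennreal_subset: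
  fixes f :: "'b \<Rightarrow> ennreal"
  assumes "A \<subseteq> B"
  shows "infsum f A \<le> infsum f B"
  using assms by (intro infsum_ennreal_least sum_le_infsum_ennreal) auto

lemma infsum_ennreal_cmult:
  fixes f :: "'b \<Rightarrow> ennreal"
  shows "infsum (\<lambda>x. c * f x) A = c * infsum f A"
proof -
  have "{} \<in> {X. finite X \<and> X \<subseteq> A}" by simp
  then have "{X. finite X \<and> X \<subseteq> A} \<noteq> {}" by blast
  then show ?thesis
    unfolding infsum_ennreal_eq_SUP by (subst SUP_mult_left_ennreal) (auto simp: sum_distrib_left)
qed

lemma infsum_ennreal_sum:
  fixes f :: "'i \<Rightarrow> 'b \<Rightarrow> ennreal"
  assumes "finite I"
  shows "infsum (\<lambda>x. \<Sum>i\<in>I. f i x) A = (\<Sum>i\<in>I. infsum (f i) A)"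
  using assms by induction (simp_all add: infsum_add summable_on_ennreal')

lemma infsum_ennreal_image_le:
  fixes f :: "'c \<Rightarrow> ennreal"
  shows "infsum f (h ` A) \<le> infsum (\<lambda>x. f (h x)) A"
proof (rule infsum_ennreal_least)
  fix X assume X: "finite X" "X \<subseteq> h ` A"
  then obtain Y where Y: "Y \<subseteq> A" "finite Y" "X = h ` Y"
    using finite_subset_image by metis
  have "sum f (h ` Y) \<le> sum (\<lambda>x. f (h x)) Y"
    using sum_image_le[of Y f h] Y(2) by simp
  also have "\<dots> \<le> infsum (\<lambda>x. f (h x)) A"
    using Y by (intro sum_le_infsum_ennreal)
  finally show "sum f X \<le> infsum (\<lambda>x. f (h x)) A" using Y by simp
qed

lemma infsum_ennreal_inj_le:
  fixes f :: "'c \<Rightarrow> ennreal"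
  assumes "inj_on h A" "h ` A \<subseteq> B"
  shows "infsum (\<lambda>x. f (h x)) A \<le> infsum f B"
proof -
  have "infsum (\<lambda>x. f (h x)) A = infsum f (h ` A)"
    using infsum_reindex[OF assms(1), of f] by (simp add: o_def)
  then show ?thesis using infsum_ennreal_subset[OF assms(2)] by simp
qed

lemma infsum_ennreal_Un_le:
  fixes f :: "'b \<Rightarrow> ennreal"
  shows "infsum f (A \<union> B) \<le> infsum f A + infsum f B"
proof -
  have "infsum f (A \<union> B) = infsum f A + infsum f (B - A)"
    using infsum_Un_disjoint[of f A "B - A"] by (simp add: summable_on_ennreal')
  also have "\<dots> \<le> infsum f A + infsum f B"
    by (intro add_left_mono infsum_ennreal_subset) auto
  finally show ?thesis .
qed

lemma infsum_ennreal_UN_le: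
  fixes f :: "'b \<Rightarrow> ennreal"
  assumes "finite I"
  shows "infsum f (\<Union>i\<in>I. A i) \<le> (\<Sum>i\<in>I. infsum f (A i))"
  using assms
proof induction
  case (insert i I)
  have "infsum f (\<Union>i\<in>insert i I. A i) \<le> infsum f (A i) + infsum f (\<Union>i\<in>I. A i)"
    by (simp add: infsum_ennreal_Un_le)
  also have "\<dots> \<le> infsum f (A i) + (\<Sum>i\<in>I. infsum f (A i))"
    using insert by (intro add_left_mono)
  finally show ?case using insert by simp
qed simp

lemma SUP_mult_SUP_le_ennreal:
  fixes f :: "'b \<Rightarrow> ennreal" and g :: "'c \<Rightarrow> ennreal"
  assumes "\<And>x y. x \<in> A \<Longrightarrow> y \<in> B \<Longrightarrow> f x * g y \<le> c"
  shows "(SUP x\<in>A. f x) * (SUP y\<in>B. g y) \<le> c"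
proof (cases "A = {} \<or> B = {}")
  case True
  then show ?thesis by (auto simp: bot_ennreal)
next
  case False
  have "(SUP x\<in>A. f x) * (SUP y\<in>B. g y) = (SUP y\<in>B. (SUP x\<in>A. f x) * g y)"
    using False by (simp add: SUP_mult_left_ennreal)
  also have "\<dots> = (SUP y\<in>B. SUP x\<in>A. f x * g y)"
    using False by (simp add: SUP_mult_right_ennreal)
  also have "\<dots> \<le> c" using assms by (intro SUP_least) auto
  finally show ?thesis .
qed

lemma infsum_ennreal_product:
  fixes f :: "'b \<Rightarrow> ennreal" and g :: "'c \<Rightarrow> ennreal"
  shows "infsum (\<lambda>(x, y). f x * g y) (A \<times> B) = infsum f A * infsum g B"
proof (rule antisym)
  show "infsum (\<lambda>(x, y). f x * g y) (A \<times> B) \<le> infsum f A * infsum g B"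
  proof (rule infsum_ennreal_least)
    fix Z assume Z: "finite Z" "Z \<subseteq> A \<times> B"
    have "sum (\<lambda>(x, y). f x * g y) Z \<le> sum (\<lambda>(x, y). f x * g y) (fst ` Z \<times> snd ` Z)"
      using Z by (intro sum_mono2) (auto intro: rev_image_eqI)
    also have "\<dots> = sum f (fst ` Z) * sum g (snd ` Z)"
      by (simp add: sum_product sum.cartesian_product)
    also have "\<dots> \<le> infsum f A * infsum g B"
      using Z by (intro mult_mono sum_le_infsum_ennreal) auto
    finally show "sum (\<lambda>(x, y). f x * g y) Z \<le> infsum f A * infsum g B" .
  qed
  show "infsum f A * infsum g B \<le> infsum (\<lambda>(x, y). f x * g y) (A \<times> B)"
    unfolding infsum_ennreal_eq_SUP[of f] infsum_ennreal_eq_SUP[of g]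
  proof (rule SUP_mult_SUP_le_ennreal)
    fix X Y assume *: "X \<in> {X. finite X \<and> X \<subseteq> A}" "Y \<in> {X. finite X \<and> X \<subseteq> B}"
    have "sum f X * sum g Y = sum (\<lambda>(x, y). f x * g y) (X \<times> Y)"
      by (simp add: sum_product sum.cartesian_product)
    also have "\<dots> \<le> infsum (\<lambda>(x, y). f x * g y) (A \<times> B)"
      using * by (intro sum_le_infsum_ennreal) auto
    finally show "sum f X * sum g Y \<le> infsum (\<lambda>(x, y). f x * g y) (A \<times> B)" .
  qed
qed

lemma eexp_le_iff: "eexp x \<le> y \<longleftrightarrow> x \<le> elog y"
proof (cases x)
  case (real r)
  then show ?thesis
    by (cases y) (auto simp: eexp_def elog_def ennreal_le_iff ln_ge_iff not_less infinity_ennreal_def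
        ennreal_eq_0_iff top_unique)
qed (auto simp: eexp_def elog_def infinity_ennreal_def top_unique)

lemma eexp_mono: "x \<le> y \<Longrightarrow> eexp x \<le> eexp y"
  by (meson eexp_le_iff order_refl order_trans)

lemma elog_mono: "x \<le> y \<Longrightarrow> elog x \<le> elog y"
  by (meson eexp_le_iff order_refl order_trans)

lemma eexp_ereal [simp]: "eexp (ereal r) = ennreal (exp r)"
  by (simp add: eexp_def)

lemma eexp_SUP: "eexp (SUP x\<in>S. h x) = (SUP x\<in>S. eexp (h x))"
proof -
  have "eexp (SUP x\<in>S. h x) \<le> y \<longleftrightarrow> (SUP x\<in>S. eexp (h x)) \<le> y" for y
    by (simp add: eexp_le_iff SUP_le_iff)
  then show ?thesis by (meson antisym order_refl)
qed

lemma elog_ennreal_exp [simp]: "elog (ennreal (exp x)) = ereal x"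
  by (simp add: elog_def ennreal_eq_0_iff)

lemma elog_le_ereal:
  assumes "elog z \<le> ereal c"
  shows "z \<le> ennreal (exp c)"
proof (cases z)
  case (real r)
  show ?thesis
  proof (cases "r = 0")
    case False
    with real assms have "r > 0" "ln r \<le> c" by (auto simp: elog_def)
    then have "r \<le> exp c" by (metis exp_ln exp_le_cancel_iff)
    then show ?thesis by (simp add: real ennreal_leI)
  qed (simp add: real)
qed (use assms in \<open>simp add: elog_def\<close>)

lemma subadditive_quotient_bound:
  fixes u :: "nat \<Rightarrow> real"
  assumes sub: "\<And>m n. u (m + n) \<le> u m + u n" and "u 0 = 0"
  shows "u (m * q + r) \<le> real q * u m + u r"
proof (induction q)
  case (Suc q)
  have "u (m * Suc q + r) = u (m + (m * q + r))" by (simp add: algebra_simps)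
  also have "\<dots> \<le> u m + u (m * q + r)" by (rule sub)
  finally show ?case using Suc by (simp add: algebra_simps)
qed simp

lemma fekete_subadditive:
  fixes u :: "nat \<Rightarrow> real"
  assumes sub: "\<And>m n. u (m + n) \<le> u m + u n" and "u 0 = 0"
  shows "(\<lambda>n. ereal (u n / real n)) \<longlonglongrightarrow> (INF n\<in>{1..}. ereal (u n / real n))"
proof (rule order_tendstoI)
  fix c assume "c < (INF n\<in>{1..}. ereal (u n / real n))"
  then have "c < ereal (u n / real n)" if "n \<ge> 1" for n
    using that by (meson INF_lower atLeast_iff less_le_trans)
  then show "\<forall>\<^sub>F n in sequentially. c < ereal (u n / real n)"
    by (auto simp: eventually_sequentially)
next
  fix c assume "(INF n\<in>{1..}. ereal (u n / real n)) < c"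
  then obtain m where m: "m \<ge> 1" "ereal (u m / real m) < c"
    by (auto simp: INF_less_iff)
  define B where "B = Max ((\<lambda>r. u r - real r * (u m / real m)) ` {..<m})"
  have bound: "u n / real n \<le> u m / real m + B / real n" if "n \<ge> 1" for n
  proof -
    have "u n \<le> real (n div m) * u m + u (n mod m)"
      using subadditive_quotient_bound[of u m "n div m" "n mod m"] assms by simp
    also have "real (n div m) = (real n - real (n mod m)) / real m"
    proof -
      have "real n = real m * real (n div m) + real (n mod m)"
        by (metis mult_div_mod_eq of_nat_add of_nat_mult)
      then show ?thesis using m by (simp add: field_simps)
    qed
    also have "(real n - real (n mod m)) / real m * u m + u (n mod m)
        = real n * (u m / real m) + (u (n mod m) - real (n mod m) * (u m / real m))"
      by (simp add: algebra_simps diff_divide_distrib)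
    also have "u (n mod m) - real (n mod m) * (u m / real m) \<le> B"
      unfolding B_def using m by (intro Max_ge) auto
    finally have "u n \<le> real n * (u m / real m) + B" by simp
    then have "u n / real n \<le> (real n * (u m / real m) + B) / real n"
      by (intro divide_right_mono) auto
    also have "\<dots> = u m / real m + B / real n"
      using that by (simp add: add_divide_distrib)
    finally show ?thesis .
  qed
  have "(\<lambda>n. u m / real m + B / real n) \<longlonglongrightarrow> u m / real m + 0"
    by (intro tendsto_add tendsto_const lim_const_over_n)
  then have "(\<lambda>n. ereal (u m / real m + B / real n)) \<longlonglongrightarrow> ereal (u m / real m)"
    by simp
  then have "\<forall>\<^sub>F n in sequentially. ereal (u m / real m + B / real n) < c"
    using m(2) by (rule order_tendstoD(2))
  then show "\<forall>\<^sub>F n in sequentially. ereal (u n / real n) < c"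
    using eventually_ge_at_top[of 1]
  proof eventually_elim
    case (elim n)
    have "ereal (u n / real n) \<le> ereal (u m / real m + B / real n)"
      using bound[OF elim(2)] by simp
    with elim(1) show ?case by (rule le_less_trans[rotated])
  qed
qed

lemma words_iff_successively:
  "\<omega> \<in> words A F n \<longleftrightarrow> length \<omega> = n \<and> set \<omega> \<subseteq> F \<and> successively (\<lambda>x y. A x y = 1) \<omega>"
  by (auto simp: words_def successively_conv_nth)

lemma fin_words_iff_successively:
  "\<omega> \<in> fin_words A F \<longleftrightarrow> set \<omega> \<subseteq> F \<and> successively (\<lambda>x y. A x y = 1) \<omega>"
  by (auto simp: fin_words_def words_iff_successively)

lemma append_in_wordsD:
  assumes "\<omega> @ \<tau> \<in> words A F n"
  shows "\<omega> \<in> words A F (length \<omega>)" "\<tau> \<in> words A F (length \<tau>)"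
  using assms by (auto simp: words_iff_successively successively_append_iff)

lemma inf_words_mono: "F \<subseteq> G \<Longrightarrow> inf_words A F \<subseteq> inf_words A G"
  by (auto simp: inf_words_def)

lemma SCons_in_inf_words:
  "i ## x \<in> inf_words A F \<longleftrightarrow> i \<in> F \<and> A i (shd x) = 1 \<and> x \<in> inf_words A F"
proof
  assume *: "i ## x \<in> inf_words A F"
  have "x !! k \<in> F \<and> A (x !! k) (x !! Suc k) = 1" for k
    using *[unfolded inf_words_def mem_Collect_eq, rule_format, of "Suc k"] by simp
  moreover have "i \<in> F \<and> A i (shd x) = 1"
    using *[unfolded inf_words_def mem_Collect_eq, rule_format, of 0] by simp
  ultimately show "i \<in> F \<and> A i (shd x) = 1 \<and> x \<in> inf_words A F"
    by (simp add: inf_words_def)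
next
  assume *: "i \<in> F \<and> A i (shd x) = 1 \<and> x \<in> inf_words A F"
  have "(i ## x) !! k \<in> F \<and> A ((i ## x) !! k) ((i ## x) !! Suc k) = 1" for k
    using * by (cases k) (auto simp: inf_words_def)
  then show "i ## x \<in> inf_words A F" by (simp add: inf_words_def)
qed

lemma shift_in_inf_words:
  "\<omega> @- x \<in> inf_words A F \<longleftrightarrow>
     set \<omega> \<subseteq> F \<and> successively (\<lambda>x y. A x y = 1) (\<omega> @ [shd x]) \<and> x \<in> inf_words A F"
proof (induction \<omega>)
  case (Cons i \<omega>)
  then show ?case
    by (cases \<omega>) (auto simp: SCons_in_inf_words)
qed simp

lemma sdrop_in_inf_words: "x \<in> inf_words A F \<Longrightarrow> sdrop n x \<in> inf_words A F"
  using shift_in_inf_words[of "stake n x" "sdrop n x"] by (simp add: stake_sdrop)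

lemma stake_in_words: "x \<in> inf_words A F \<Longrightarrow> stake n x \<in> words A F n"
  using shift_in_inf_words[of "stake n x" "sdrop n x"]
  by (simp add: stake_sdrop words_iff_successively successively_append_iff)

lemma shd_in_alphabet: "x \<in> inf_words A F \<Longrightarrow> shd x \<in> F"
  by (auto simp: inf_words_def dest: spec[of _ 0])

lemma cylinderD:
  assumes "x \<in> cylinder A F \<omega>"
  shows "x \<in> inf_words A F" "stake (length \<omega>) x = \<omega>" "\<omega> @- sdrop (length \<omega>) x = x"
  using assms stake_sdrop[of "length \<omega>" x] by (auto simp: cylinder_def)

lemma cylinder_mono: "F \<subseteq> G \<Longrightarrow> cylinder A F \<omega> \<subseteq> cylinder A G \<omega>"
  using inf_words_mono[of F G A] by (auto simp: cylinder_def)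

lemma cylinder_nonempty_imp_word:
  assumes "cylinder A F \<omega> \<noteq> {}"
  shows "\<omega> \<in> words A F (length \<omega>)"
  using assms stake_in_words[of _ A F "length \<omega>"] by (force simp: cylinder_def)

lemma cylinder_appendD:
  assumes "x \<in> cylinder A F (\<omega> @ \<tau>)"
  shows "x \<in> cylinder A F \<omega>" "sdrop (length \<omega>) x \<in> cylinder A F \<tau>"
proof -
  from assms have x: "x \<in> inf_words A F"
    and "stake (length \<omega>) x @ stake (length \<tau>) (sdrop (length \<omega>) x) = \<omega> @ \<tau>"
    by (simp_all add: cylinder_def)
  then have "stake (length \<omega>) x = \<omega> \<and> stake (length \<tau>) (sdrop (length \<omega>) x) = \<tau>"
    by (subst (asm) append_eq_append_conv) auto
  with x show "x \<in> cylinder A F \<omega>" "sdrop (length \<omega>) x \<in> cylinder A F \<tau>"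
    by (simp_all add: cylinder_def sdrop_in_inf_words)
qed

lemma birkhoff_sum_0 [simp]: "birkhoff_sum f 0 x = 0"
  by (simp add: birkhoff_sum_def)

lemma birkhoff_sum_Suc_0 [simp]: "birkhoff_sum f (Suc 0) x = f x"
  by (simp add: birkhoff_sum_def)

lemma birkhoff_sum_add:
  "birkhoff_sum f (m + n) x = birkhoff_sum f m x + birkhoff_sum f n (sdrop m x)"
proof -
  have "{..<m + n} = {..<m} \<union> {m..<m + n}" by auto
  then have "birkhoff_sum f (m + n) x = birkhoff_sum f m x + (\<Sum>j\<in>{m..<m + n}. f (sdrop j x))"
    by (simp add: birkhoff_sum_def sum.union_disjoint ivl_disj_int)
  also have "(\<Sum>j\<in>{m..<m + n}. f (sdrop j x)) = birkhoff_sum f n (sdrop m x)"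
    unfolding birkhoff_sum_def
    by (rule sum.reindex_bij_witness[of _ "\<lambda>j. m + j" "\<lambda>j. j - m"]) auto
  finally show ?thesis .
qed

definition cylinder_weight ::
  "('a \<Rightarrow> 'a \<Rightarrow> nat) \<Rightarrow> 'a set \<Rightarrow> ('a stream \<Rightarrow> real) \<Rightarrow> 'a list \<Rightarrow> ennreal" where
  "cylinder_weight A F f \<omega> =
     (SUP x\<in>cylinder A F \<omega>. ennreal (exp (birkhoff_sum f (length \<omega>) x)))"

definition relative_partition ::
  "('a \<Rightarrow> 'a \<Rightarrow> nat) \<Rightarrow> 'a set \<Rightarrow> 'a set \<Rightarrow> ('a stream \<Rightarrow> real) \<Rightarrow> nat \<Rightarrow> ennreal" where
  "relative_partition A F G f n = (\<Sum>\<^sub>\<infinity>\<omega>\<in>words A F n. cylinder_weight A G f \<omega>)"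

lemma partition_function_eq:
  "partition_function A F f n = relative_partition A F F f n"
  unfolding partition_function_def relative_partition_def
  by (rule infsum_cong)
     (auto simp: cylinder_weight_def eexp_SUP words_def)

lemma cylinder_weight_mono: "F \<subseteq> G \<Longrightarrow> cylinder_weight A F f \<omega> \<le> cylinder_weight A G f \<omega>"
  unfolding cylinder_weight_def by (intro SUP_subset_mono cylinder_mono) auto

lemma cylinder_weight_lower:
  "x \<in> cylinder A F \<omega> \<Longrightarrow> ennreal (exp (birkhoff_sum f (length \<omega>) x)) \<le> cylinder_weight A F f \<omega>"
  unfolding cylinder_weight_def by (rule SUP_upper)

lemma cylinder_weight_eq_0:
  assumes "\<omega> \<notin> words A F (length \<omega>)"
  shows "cylinder_weight A F f \<omega> = 0"
proof -
  have "cylinder A F \<omega> = {}" using assms cylinder_nonempty_imp_word by blast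
  then show ?thesis by (simp add: cylinder_weight_def bot_ennreal)
qed

lemma cylinder_weight_append_le:
  "cylinder_weight A F f (\<omega> @ \<tau>) \<le> cylinder_weight A F f \<omega> * cylinder_weight A F f \<tau>"
proof -
  have "ennreal (exp (birkhoff_sum f (length (\<omega> @ \<tau>)) x))
      \<le> cylinder_weight A F f \<omega> * cylinder_weight A F f \<tau>" if "x \<in> cylinder A F (\<omega> @ \<tau>)" for x
  proof -
    have "ennreal (exp (birkhoff_sum f (length (\<omega> @ \<tau>)) x))
        = ennreal (exp (birkhoff_sum f (length \<omega>) x))
          * ennreal (exp (birkhoff_sum f (length \<tau>) (sdrop (length \<omega>) x)))"
      by (simp add: birkhoff_sum_add exp_add ennreal_mult)
    also have "\<dots> \<le> cylinder_weight A F f \<omega> * cylinder_weight A F f \<tau>"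
      using cylinder_appendD[OF that] by (intro mult_mono cylinder_weight_lower) auto
    finally show ?thesis .
  qed
  then show ?thesis
    unfolding cylinder_weight_def[of A F f "\<omega> @ \<tau>"] by (intro SUP_least)
qed

lemma relative_partition_0:
  assumes "inf_words A G \<noteq> {}"
  shows "relative_partition A F G f 0 = 1"
proof -
  have "words A F 0 = {[]}" by (auto simp: words_def)
  moreover have "cylinder A G [] \<noteq> {}" using assms by (auto simp: cylinder_def)
  ultimately show ?thesis
    by (simp add: relative_partition_def cylinder_weight_def)
qed

lemma relative_partition_pos:
  assumes "inf_words A F \<noteq> {}"
  shows "relative_partition A F F f n > 0"
proof -
  from assms obtain x where x: "x \<in> inf_words A F" by blast
  have "0 < ennreal (exp (birkhoff_sum f n x))" by simp
  also have "\<dots> \<le> cylinder_weight A F f (stake n x)"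
    using cylinder_weight_lower[of x A F "stake n x" f] x by (simp add: cylinder_def)
  also have "\<dots> \<le> relative_partition A F F f n"
    unfolding relative_partition_def
    using sum_le_infsum_ennreal[of "{stake n x}" "words A F n" "cylinder_weight A F f"] x
    by (simp add: stake_in_words)
  finally show ?thesis .
qed

lemma relative_partition_add_le:
  "relative_partition A F G f (m + n) \<le> relative_partition A F G f m * relative_partition A F G f n"
proof -
  have "relative_partition A F G f (m + n)
      \<le> (\<Sum>\<^sub>\<infinity>\<omega>\<in>words A F (m + n).
            case (take m \<omega>, drop m \<omega>) of (\<rho>, \<tau>) \<Rightarrow> cylinder_weight A G f \<rho> * cylinder_weight A G f \<tau>)"
    unfolding relative_partition_def
  proof (rule infsum_ennreal_mono)
    fix \<omega>
    show "cylinder_weight A G f \<omega> \<le> (case (take m \<omega>, drop m \<omega>) of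
      (\<rho>, \<tau>) \<Rightarrow> cylinder_weight A G f \<rho> * cylinder_weight A G f \<tau>)"
      using cylinder_weight_append_le[of A G f "take m \<omega>" "drop m \<omega>"] by simp
  qed
  also have "\<dots> \<le> (\<Sum>\<^sub>\<infinity>(\<rho>, \<tau>)\<in>words A F m \<times> words A F n.
      cylinder_weight A G f \<rho> * cylinder_weight A G f \<tau>)"
  proof (rule infsum_ennreal_inj_le[where h = "\<lambda>\<omega>. (take m \<omega>, drop m \<omega>)"])
    show "inj_on (\<lambda>\<omega>. (take m \<omega>, drop m \<omega>)) (words A F (m + n))"
      by (rule inj_onI) (metis append_take_drop_id prod.inject)
    show "(\<lambda>\<omega>. (take m \<omega>, drop m \<omega>)) ` words A F (m + n) \<subseteq> words A F m \<times> words A F n"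
    proof (clarify, intro conjI)
      fix \<omega> assume *: "\<omega> \<in> words A F (m + n)"
      then have "length \<omega> = m + n" by (simp add: words_def)
      then show "take m \<omega> \<in> words A F m" "drop m \<omega> \<in> words A F n"
        using append_in_wordsD[of "take m \<omega>" "drop m \<omega>" A F "m + n"] * by simp_all
    qed
  qed
  also have "\<dots> = relative_partition A F G f m * relative_partition A F G f n"
    by (simp add: infsum_ennreal_product relative_partition_def)
  finally show ?thesis .
qed

lemma pressure_converges:
  assumes "inf_words A F \<noteq> {}" and "partition_function A F f 1 < \<infinity>"
  shows "(\<lambda>n. ereal (1 / real n) * elog (partition_function A F f n)) \<longlonglongrightarrow> pressure A F f"
    and "\<And>n. partition_function A F f n < \<infinity>"
proof -
  define Z where "Z = partition_function A F f"
  have Z0: "Z 0 = 1" and Zpos: "Z n > 0" and Zadd: "Z (m + n) \<le> Z m * Z n" for m n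
    using assms(1) relative_partition_0 relative_partition_pos relative_partition_add_le
    by (simp_all add: Z_def partition_function_eq)
  have Zfin: "Z n < \<infinity>" for n
  proof (induction n)
    case (Suc n)
    have "Z (Suc n) \<le> Z n * Z 1" using Zadd[of n 1] by simp
    also have "\<dots> < \<infinity>" using Suc assms(2) by (simp add: Z_def ennreal_mult_less_top)
    finally show ?case .
  qed (simp add: Z0)
  then show "partition_function A F f n < \<infinity>" for n by (simp add: Z_def)
  define u where "u n = ln (enn2real (Z n))" for n
  have Zpos': "enn2real (Z n) > 0" for n
    using Zpos[of n] Zfin[of n] by (simp add: enn2real_positive_iff)
  have "u 0 = 0" by (simp add: u_def Z0)
  moreover have "u (m + n) \<le> u m + u n" for m n
  proof -
    have "enn2real (Z (m + n)) \<le> enn2real (Z m * Z n)"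
      using Zadd[of m n] Zfin by (intro enn2real_mono) (auto simp: ennreal_mult_less_top)
    then show ?thesis
      using Zpos' by (simp add: u_def enn2real_mult flip: ln_mult_pos)
  qed
  ultimately have "(\<lambda>n. ereal (u n / real n)) \<longlonglongrightarrow> (INF n\<in>{1..}. ereal (u n / real n))"
    by (intro fekete_subadditive)
  moreover have "ereal (u n / real n) = ereal (1 / real n) * elog (Z n)" for n
    using Zpos[of n] Zfin[of n] by (auto simp: elog_def u_def)
  ultimately have *: "(\<lambda>n. ereal (1 / real n) * elog (Z n)) \<longlonglongrightarrow> (INF n\<in>{1..}. ereal (u n / real n))"
    by simp
  then have "pressure A F f = (INF n\<in>{1..}. ereal (u n / real n))"
    unfolding pressure_def Z_def by (rule limI)
  with * show "(\<lambda>n. ereal (1 / real n) * elog (partition_function A F f n)) \<longlonglongrightarrow> pressure A F f"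
    by (simp add: Z_def)
qed

lemma pressure_no_inf_words:
  assumes "inf_words A F = {}"
  shows "pressure A F f = -\<infinity>"
proof -
  have "partition_function A F f n = 0" for n
    unfolding partition_function_def
    by (intro infsum_0) (simp add: cylinder_def assms eexp_def bot_ereal_def)
  then have "(\<lambda>n. ereal (1 / real n) * elog (partition_function A F f n)) = (\<lambda>n. if n = 0 then 0 else -\<infinity>)"
    by (auto simp: elog_def)
  moreover have "\<forall>\<^sub>F n::nat in sequentially. (if n = 0 then 0 else -\<infinity>) = (-\<infinity>::ereal)"
    using eventually_ge_at_top[of 1] by eventually_elim auto
  then have "(\<lambda>n::nat. if n = 0 then 0 else -\<infinity>) \<longlonglongrightarrow> (-\<infinity>::ereal)"
    by (rule tendsto_eventually)
  ultimately show ?thesis unfolding pressure_def by (simp add: limI)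
qed

lemma pressure_infinite_partition:
  assumes "\<And>n. n \<ge> 1 \<Longrightarrow> partition_function A F f n = \<infinity>"
  shows "pressure A F f = \<infinity>"
proof -
  have "\<forall>\<^sub>F n in sequentially. ereal (1 / real n) * elog (partition_function A F f n) = \<infinity>"
    using eventually_ge_at_top[of 1] by eventually_elim (simp add: assms elog_def)
  then show ?thesis unfolding pressure_def by (intro limI tendsto_eventually)
qed

lemma Holder_bound:
  assumes "Holder A E \<alpha> f"
  obtains C where "C \<ge> 0"
    and "\<And>n x y. n \<ge> 1 \<Longrightarrow> x \<in> inf_words A E \<Longrightarrow> y \<in> inf_words A E \<Longrightarrow> stake n x = stake n y \<Longrightarrow>
      \<bar>f x - f y\<bar> \<le> C * exp (- \<alpha>) ^ (n - 1)"
proof -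
  define S where "S = (SUP n \<in> {1..}. Sup {ereal (\<bar>f \<omega> - f \<tau>\<bar> * exp (\<alpha> * (real n - 1))) | \<omega> \<tau>.
        \<omega> \<in> inf_words A E \<and> \<tau> \<in> inf_words A E \<and> common_length \<omega> \<tau> \<ge> enat n})"
  have "S < \<infinity>" using assms by (simp add: Holder_def S_def)
  show thesis
  proof (rule that[of "max 0 (real_of_ereal S)"])
    fix n :: nat and x y
    assume *: "n \<ge> 1" "x \<in> inf_words A E" "y \<in> inf_words A E" "stake n x = stake n y"
    then have "enat n \<le> common_length x y"
      unfolding common_length_def by (intro SUP_upper) simp
    then have "ereal (\<bar>f x - f y\<bar> * exp (\<alpha> * (real n - 1)))
        \<le> Sup {ereal (\<bar>f \<omega> - f \<tau>\<bar> * exp (\<alpha> * (real n - 1))) | \<omega> \<tau>.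
        \<omega> \<in> inf_words A E \<and> \<tau> \<in> inf_words A E \<and> common_length \<omega> \<tau> \<ge> enat n}"
      using * by (intro Sup_upper) blast
    also have "\<dots> \<le> S" unfolding S_def using * by (intro SUP_upper) simp
    finally have "\<bar>f x - f y\<bar> * exp (\<alpha> * (real n - 1)) \<le> real_of_ereal S"
      using \<open>S < \<infinity>\<close> by (cases S) auto
    then have "\<bar>f x - f y\<bar> \<le> real_of_ereal S / exp (\<alpha> * (real n - 1))"
      by (simp add: pos_le_divide_eq)
    then have "\<bar>f x - f y\<bar> \<le> real_of_ereal S * exp (- (\<alpha> * (real n - 1)))"
      unfolding exp_minus divide_inverse .
    also have "\<dots> \<le> max 0 (real_of_ereal S) * exp (- (\<alpha> * (real n - 1)))"
      by (intro mult_right_mono) auto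
    also have "exp (- (\<alpha> * (real n - 1))) = exp (- \<alpha>) ^ (n - 1)"
      using * by (simp add: of_nat_diff mult.commute flip: exp_of_nat_mult)
    finally show "\<bar>f x - f y\<bar> \<le> max 0 (real_of_ereal S) * exp (- \<alpha>) ^ (n - 1)" .
  qed simp
qed

lemma Holder_bounded_distortion:
  assumes "Holder A E \<alpha> f" "\<alpha> > 0"
  shows "\<exists>M>0. \<forall>n x y. x \<in> inf_words A E \<longrightarrow> y \<in> inf_words A E \<longrightarrow> stake n x = stake n y \<longrightarrow>
      \<bar>birkhoff_sum f n x - birkhoff_sum f n y\<bar> \<le> M"
proof -
  obtain C where "C \<ge> 0" and C: "\<And>n x y. n \<ge> 1 \<Longrightarrow> x \<in> inf_words A E \<Longrightarrow> y \<in> inf_words A E \<Longrightarrow>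
      stake n x = stake n y \<Longrightarrow> \<bar>f x - f y\<bar> \<le> C * exp (- \<alpha>) ^ (n - 1)"
    using Holder_bound[OF assms(1)] by metis
  define r where "r = exp (- \<alpha>)"
  have r: "0 < r" "r < 1" using \<open>\<alpha> > 0\<close> by (auto simp: r_def)
  have "\<bar>birkhoff_sum f n x - birkhoff_sum f n y\<bar> \<le> C / (1 - r) + 1"
    if *: "x \<in> inf_words A E" "y \<in> inf_words A E" "stake n x = stake n y" for n x y
  proof -
    have "\<bar>birkhoff_sum f n x - birkhoff_sum f n y\<bar> \<le> (\<Sum>j<n. \<bar>f (sdrop j x) - f (sdrop j y)\<bar>)"
      unfolding birkhoff_sum_def sum_subtractf[symmetric] by (rule sum_abs)
    also have "\<dots> \<le> (\<Sum>j<n. C * r ^ (n - Suc j))"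
    proof (rule sum_mono)
      fix j assume "j \<in> {..<n}"
      moreover have "stake (n - j) (sdrop j x) = stake (n - j) (sdrop j y)"
        using *(3) by (simp flip: drop_stake)
      ultimately show "\<bar>f (sdrop j x) - f (sdrop j y)\<bar> \<le> C * r ^ (n - Suc j)"
        using C[of "n - j" "sdrop j x" "sdrop j y"] * by (simp add: sdrop_in_inf_words r_def)
    qed
    also have "\<dots> = C * ((1 - r ^ n) / (1 - r))"
      using sum.nat_diff_reindex[of "\<lambda>i. C * r ^ i" n] r
      by (simp add: sum_gp_strict flip: sum_distrib_left)
    also have "\<dots> \<le> C * (1 / (1 - r))"
      using r \<open>C \<ge> 0\<close> by (intro mult_left_mono divide_right_mono) auto
    finally show ?thesis by simp
  qed
  moreover have "C / (1 - r) + 1 > 0"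
    using r \<open>C \<ge> 0\<close> by (intro add_nonneg_pos divide_nonneg_pos) auto
  ultimately show ?thesis by blast
qed

lemma
  assumes "Holder A E \<alpha> f" "\<alpha> > 0"
  shows distortion_nonneg: "0 \<le> distortion A E f"
    and distortion_bound: "\<And>x y. x \<in> cylinder A E \<omega> \<Longrightarrow> y \<in> cylinder A E \<omega> \<Longrightarrow>
      birkhoff_sum f (length \<omega>) x \<le> birkhoff_sum f (length \<omega>) y + distortion A E f"
proof -
  define D where "D = {M. M > 0 \<and>
     (\<forall>n\<ge>1. \<forall>\<rho>\<in>words A E n. \<forall>\<omega>\<in>inf_words A E. \<forall>\<tau>\<in>inf_words A E.
        \<rho> @- \<omega> \<in> inf_words A E \<longrightarrow> \<rho> @- \<tau> \<in> inf_words A E \<longrightarrow>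
        \<bar>birkhoff_sum f n (\<rho> @- \<omega>) - birkhoff_sum f n (\<rho> @- \<tau>)\<bar> \<le> M)}"
  have dist: "distortion A E f = Inf D" by (simp add: distortion_def D_def)
  obtain M where M: "M > 0" "\<And>n x y. x \<in> inf_words A E \<Longrightarrow> y \<in> inf_words A E \<Longrightarrow> stake n x = stake n y \<Longrightarrow>
      \<bar>birkhoff_sum f n x - birkhoff_sum f n y\<bar> \<le> M"
    using Holder_bounded_distortion[OF assms] by blast
  have "M \<in> D"
    using M by (auto simp: D_def words_def stake_shift)
  then have ne: "D \<noteq> {}" by blast
  show nonneg: "0 \<le> distortion A E f"
    unfolding dist using ne by (rule cInf_greatest) (simp add: D_def)
  fix x y assume *: "x \<in> cylinder A E \<omega>" "y \<in> cylinder A E \<omega>"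
  show "birkhoff_sum f (length \<omega>) x \<le> birkhoff_sum f (length \<omega>) y + distortion A E f"
  proof (cases "\<omega> = []")
    case True
    then show ?thesis using nonneg by simp
  next
    case False
    have "birkhoff_sum f (length \<omega>) x - birkhoff_sum f (length \<omega>) y \<le> Inf D"
    proof (rule cInf_greatest[OF ne])
      fix M assume "M \<in> D"
      moreover have "\<omega> \<in> words A E (length \<omega>)" using * cylinder_nonempty_imp_word by blast
      moreover have "length \<omega> \<ge> 1" using False by (cases \<omega>) auto
      moreover have "\<omega> @- sdrop (length \<omega>) x = x" "\<omega> @- sdrop (length \<omega>) y = y"
        "x \<in> inf_words A E" "y \<in> inf_words A E"
        using * by (auto dest: cylinderD)
      ultimately have "\<bar>birkhoff_sum f (length \<omega>) x - birkhoff_sum f (length \<omega>) y\<bar> \<le> M"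
        unfolding D_def mem_Collect_eq by (metis sdrop_in_inf_words)
      then show "birkhoff_sum f (length \<omega>) x - birkhoff_sum f (length \<omega>) y \<le> M" by linarith
    qed
    then show ?thesis by (simp add: dist)
  qed
qed

lemma cylinder_weight_distortion:
  assumes "Holder A E \<alpha> f" "\<alpha> > 0" and x: "x \<in> cylinder A E \<omega>"
  shows "cylinder_weight A E f \<omega> \<le> ennreal (exp (birkhoff_sum f (length \<omega>) x + distortion A E f))"
  unfolding cylinder_weight_def
  using distortion_bound[OF assms(1,2) _ x] by (intro SUP_least ennreal_leI) auto

lemma kappa_le:
  assumes "finite \<Lambda>" "\<mu> \<in> \<Lambda>" "x \<in> cylinder A E \<mu>"
  shows "kappa A E \<Lambda> f \<le> exp (birkhoff_sum f (length \<mu>) x)"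
proof -
  have "kappa A E \<Lambda> f \<le> (INF \<tau>\<in>cylinder A E \<mu>. exp (birkhoff_sum f (length \<mu>) \<tau>))"
    unfolding kappa_def using assms by (intro Min_le) auto
  also have "\<dots> \<le> exp (birkhoff_sum f (length \<mu>) x)"
    using assms by (intro cINF_lower bdd_belowI[of _ 0]) auto
  finally show ?thesis .
qed

lemma kappa_pos:
  assumes "Holder A E \<alpha> f" "\<alpha> > 0" "finite \<Lambda>" "\<Lambda> \<noteq> {}"
    and "\<And>\<mu>. \<mu> \<in> \<Lambda> \<Longrightarrow> cylinder A E \<mu> \<noteq> {}"
  shows "kappa A E \<Lambda> f > 0"
proof -
  have "(INF \<tau>\<in>cylinder A E \<mu>. exp (birkhoff_sum f (length \<mu>) \<tau>)) > 0" if \<mu>: "\<mu> \<in> \<Lambda>" for \<mu>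
  proof -
    obtain x where x: "x \<in> cylinder A E \<mu>" using assms(5)[OF \<mu>] by blast
    have "0 < exp (birkhoff_sum f (length \<mu>) x - distortion A E f)" by simp
    also have "\<dots> \<le> (INF \<tau>\<in>cylinder A E \<mu>. exp (birkhoff_sum f (length \<mu>) \<tau>))"
      using distortion_bound[OF assms(1,2) x] x
      by (intro cINF_greatest) (auto simp: algebra_simps)
    finally show ?thesis .
  qed
  then show ?thesis using assms by (simp add: kappa_def)
qed

lemma connecting_word:
  assumes "witnesses_irreducibility A F \<Lambda>" "\<omega> \<in> words A F n" "j \<in> F"
  shows "\<exists>\<mu>\<in>\<Lambda>. \<forall>x\<in>inf_words A F. shd x = j \<longrightarrow> \<omega> @- \<mu> @- x \<in> inf_words A F"
proof (cases "\<omega> = []")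
  case True
  from assms(1,3) obtain \<mu> where "\<mu> \<in> \<Lambda>" "[j] @ \<mu> @ [j] \<in> fin_words A F"
    unfolding witnesses_irreducibility_def by blast
  then show ?thesis using True
    by (intro bexI[of _ \<mu>])
       (auto simp: shift_in_inf_words fin_words_iff_successively successively_Cons)
next
  case False
  with assms have "last \<omega> \<in> F" by (auto simp: words_def)
  with assms(1,3) obtain \<mu> where \<mu>: "\<mu> \<in> \<Lambda>" "[last \<omega>] @ \<mu> @ [j] \<in> fin_words A F"
    unfolding witnesses_irreducibility_def by blast
  have "\<omega> @- \<mu> @- x \<in> inf_words A F" if "x \<in> inf_words A F" "shd x = j" for x
  proof -
    have "\<mu> @- x \<in> inf_words A F"
      using \<mu> that by (auto simp: shift_in_inf_words fin_words_iff_successively successively_Cons)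
    moreover have "shd (\<mu> @- x) = hd (\<mu> @ [j])" using that by (cases \<mu>) auto
    moreover have "A (last \<omega>) (hd (\<mu> @ [j])) = 1"
      using \<mu> by (auto simp: fin_words_iff_successively successively_Cons)
    ultimately show ?thesis
      using assms(2) False unfolding shift_in_inf_words[of \<omega>]
      by (auto simp: words_iff_successively successively_append_iff)
  qed
  with \<mu> show ?thesis by blast
qed

lemma cylinder_nonempty:
  assumes "witnesses_irreducibility A F \<Lambda>" "\<omega> \<in> words A F n" "inf_words A F \<noteq> {}"
  shows "cylinder A F \<omega> \<noteq> {}"
proof -
  from assms(3) obtain x where x: "x \<in> inf_words A F" by blast
  from connecting_word[OF assms(1,2) shd_in_alphabet[OF x]] x
  obtain \<mu> where "\<omega> @- \<mu> @- x \<in> inf_words A F" by blast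
  then have "\<omega> @- \<mu> @- x \<in> cylinder A F \<omega>"
    by (simp add: cylinder_def stake_shift)
  then show ?thesis by blast
qed

lemma weight_join_le:
  assumes H: "Holder A E \<alpha> f" "\<alpha> > 0" and FE: "F \<subseteq> E" and W: "witnesses_irreducibility A F \<Lambda>"
    and \<omega>: "\<omega> \<in> words A F n" and \<tau>: "\<tau> \<noteq> []"
    and pos: "kappa A E \<Lambda> f \<ge> 0"
  shows "ennreal (kappa A E \<Lambda> f * exp (- distortion A E f)) * (cylinder_weight A E f \<omega> * cylinder_weight A F f \<tau>)
    \<le> (\<Sum>\<mu>\<in>\<Lambda>. cylinder_weight A F f (\<omega> @ \<mu> @ \<tau>))"
proof (cases "cylinder A F \<tau> = {}")
  case True
  then show ?thesis by (simp add: cylinder_weight_def[of A F f \<tau>] bot_ennreal)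
next
  case False
  let ?\<kappa> = "kappa A E \<Lambda> f" and ?L = "distortion A E f"
  have fin: "finite \<Lambda>" using W by (simp add: witnesses_irreducibility_def)
  have "hd \<tau> \<in> F"
    using cylinder_nonempty_imp_word[OF False] \<tau> by (auto simp: words_def)
  from connecting_word[OF W \<omega> this] obtain \<mu> where \<mu>: "\<mu> \<in> \<Lambda>"
    and join: "\<And>x. x \<in> inf_words A F \<Longrightarrow> shd x = hd \<tau> \<Longrightarrow> \<omega> @- \<mu> @- x \<in> inf_words A F"
    by blast
  have "(ennreal (?\<kappa> * exp (- ?L)) * cylinder_weight A E f \<omega>) * ennreal (exp (birkhoff_sum f (length \<tau>) x))
      \<le> cylinder_weight A F f (\<omega> @ \<mu> @ \<tau>)" if x: "x \<in> cylinder A F \<tau>" for x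
  proof -
    let ?z = "\<omega> @- \<mu> @- x"
    have "shd x = hd \<tau>" using \<tau> cylinderD(3)[OF x] by (cases \<tau>) (auto, metis stream.sel(1))
    then have z: "?z \<in> inf_words A F" using join cylinderD(1)[OF x] by blast
    have zF: "?z \<in> cylinder A F (\<omega> @ \<mu> @ \<tau>)"
      using z cylinderD(2)[OF x] by (simp add: cylinder_def stake_shift)
    then have zE: "?z \<in> cylinder A E (\<omega> @ \<mu> @ \<tau>)"
      using cylinder_mono[OF FE] by blast
    have "sdrop (length \<omega>) ?z \<in> cylinder A E \<mu>"
      using zE by (blast dest: cylinder_appendD)
    then have "\<mu> @- x \<in> cylinder A E \<mu>" by (simp add: sdrop_shift)
    then have \<kappa>: "?\<kappa> \<le> exp (birkhoff_sum f (length \<mu>) (\<mu> @- x))"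
      using fin \<mu> by (intro kappa_le)
    have "cylinder_weight A E f \<omega> \<le> ennreal (exp (birkhoff_sum f (length \<omega>) ?z + ?L))"
      using H zE by (intro cylinder_weight_distortion) (blast dest: cylinder_appendD)+
    then have "(ennreal (?\<kappa> * exp (- ?L)) * cylinder_weight A E f \<omega>) * ennreal (exp (birkhoff_sum f (length \<tau>) x))
      \<le> (ennreal (?\<kappa> * exp (- ?L)) * ennreal (exp (birkhoff_sum f (length \<omega>) ?z + ?L))) * ennreal (exp (birkhoff_sum f (length \<tau>) x))"
      by (intro mult_right_mono mult_left_mono) auto
    also have "\<dots> = ennreal (?\<kappa> * exp (birkhoff_sum f (length \<omega>) ?z + birkhoff_sum f (length \<tau>) x))"
      using pos by (simp add: exp_add exp_minus field_simps flip: ennreal_mult)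
    also have "\<dots> \<le> ennreal (exp (birkhoff_sum f (length \<mu>) (\<mu> @- x))
        * exp (birkhoff_sum f (length \<omega>) ?z + birkhoff_sum f (length \<tau>) x))"
      using \<kappa> by (intro ennreal_leI mult_right_mono) auto
    also have "\<dots> = ennreal (exp (birkhoff_sum f (length (\<omega> @ \<mu> @ \<tau>)) ?z))"
    proof -
      have "birkhoff_sum f (length (\<omega> @ \<mu> @ \<tau>)) ?z = birkhoff_sum f (length \<omega>) ?z
          + (birkhoff_sum f (length \<mu>) (\<mu> @- x) + birkhoff_sum f (length \<tau>) x)"
        by (simp add: birkhoff_sum_add sdrop_shift)
      then show ?thesis by (simp add: exp_add)
    qed
    also have "\<dots> \<le> cylinder_weight A F f (\<omega> @ \<mu> @ \<tau>)"
      using zF by (rule cylinder_weight_lower)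
    finally show ?thesis .
  qed
  then have "(ennreal (?\<kappa> * exp (- ?L)) * cylinder_weight A E f \<omega>) * cylinder_weight A F f \<tau>
      \<le> cylinder_weight A F f (\<omega> @ \<mu> @ \<tau>)"
    using False unfolding cylinder_weight_def[of A F f \<tau>]
    by (subst SUP_mult_left_ennreal) (auto intro: SUP_least)
  also have "\<dots> \<le> (\<Sum>\<mu>\<in>\<Lambda>. cylinder_weight A F f (\<omega> @ \<mu> @ \<tau>))"
    using fin \<mu> by (intro member_le_sum) auto
  finally show ?thesis by (simp add: mult.assoc)
qed

lemma relative_partition_join_le:
  fixes A :: "'a \<Rightarrow> 'a \<Rightarrow> nat"
  assumes "Holder A E \<alpha> f" "\<alpha> > 0" "F \<subseteq> E" "witnesses_irreducibility A F \<Lambda>"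
    and "kappa A E \<Lambda> f \<ge> 0" and N: "N \<ge> 1"
  shows "ennreal (kappa A E \<Lambda> f * exp (- distortion A E f))
      * (relative_partition A F E f n * relative_partition A F F f N)
    \<le> (\<Sum>\<mu>\<in>\<Lambda>. relative_partition A F F f (n + length \<mu> + N))"
proof -
  let ?c = "ennreal (kappa A E \<Lambda> f * exp (- distortion A E f))"
  have fin: "finite \<Lambda>" using assms(4) by (simp add: witnesses_irreducibility_def)
  have "?c * (relative_partition A F E f n * relative_partition A F F f N)
      = (\<Sum>\<^sub>\<infinity>p\<in>words A F n \<times> words A F N.
          ?c * (case p of (\<omega>, \<tau>) \<Rightarrow> cylinder_weight A E f \<omega> * cylinder_weight A F f \<tau>))"
    by (simp add: relative_partition_def infsum_ennreal_product infsum_ennreal_cmult)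
  also have "\<dots> \<le> (\<Sum>\<^sub>\<infinity>p\<in>words A F n \<times> words A F N.
      \<Sum>\<mu>\<in>\<Lambda>. cylinder_weight A F f (fst p @ \<mu> @ snd p))"
  proof (rule infsum_ennreal_mono)
    fix p assume p: "p \<in> words A F n \<times> words A F N"
    then have "snd p \<noteq> []" using N by (auto simp: words_def)
    then show "?c * (case p of (\<omega>, \<tau>) \<Rightarrow> cylinder_weight A E f \<omega> * cylinder_weight A F f \<tau>)
      \<le> (\<Sum>\<mu>\<in>\<Lambda>. cylinder_weight A F f (fst p @ \<mu> @ snd p))"
      using weight_join_le[OF assms(1-4), of "fst p" n "snd p"] p assms(5) by (auto simp: case_prod_unfold)
  qed
  also have "\<dots> = (\<Sum>\<mu>\<in>\<Lambda>. \<Sum>\<^sub>\<infinity>p\<in>words A F n \<times> words A F N. cylinder_weight A F f (fst p @ \<mu> @ snd p))"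
    using fin by (rule infsum_ennreal_sum)
  also have "\<dots> \<le> (\<Sum>\<mu>\<in>\<Lambda>. relative_partition A F F f (n + length \<mu> + N))"
  proof (rule sum_mono)
    fix \<mu> :: "'a list"
    let ?U = "{\<omega>. length \<omega> = n + length \<mu> + N} :: 'a list set"
    have "(\<Sum>\<^sub>\<infinity>p\<in>words A F n \<times> words A F N. cylinder_weight A F f (fst p @ \<mu> @ snd p))
        \<le> infsum (cylinder_weight A F f) ?U"
      by (rule infsum_ennreal_inj_le) (auto simp: inj_on_def words_def)
    also have "\<dots> = relative_partition A F F f (n + length \<mu> + N)"
      unfolding relative_partition_def
      by (rule infsum_cong_neutral)
         (auto simp: words_def intro!: cylinder_weight_eq_0)
    finally show "(\<Sum>\<^sub>\<infinity>p\<in>words A F n \<times> words A F N. cylinder_weight A F f (fst p @ \<mu> @ snd p))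
      \<le> relative_partition A F F f (n + length \<mu> + N)" .
  qed
  finally show ?thesis .
qed

lemma relative_partition_growth:
  fixes A :: "'a \<Rightarrow> 'a \<Rightarrow> nat"
  assumes H: "Holder A E \<alpha> f" "\<alpha> > 0" and FE: "F \<subseteq> E"
    and W: "witnesses_irreducibility A F \<Lambda>" and "\<Lambda> \<noteq> {}"
    and F: "inf_words A F \<noteq> {}" "partition_function A F f 1 < \<infinity>"
    and P: "pressure A F f = ereal p" "p \<ge> 0"
  shows "relative_partition A F E f n \<le>
    ennreal (real (card \<Lambda>) * exp (distortion A E f) / kappa A E \<Lambda> f
      * exp (real (max_length \<Lambda>) * p) * exp p ^ n)"
proof -
  let ?\<kappa> = "kappa A E \<Lambda> f" and ?L = "distortion A E f" and ?q = "max_length \<Lambda>"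
  let ?c = "ennreal (?\<kappa> * exp (- ?L))" and ?W = "relative_partition A F E f n"
  define Z where "Z = relative_partition A F F f"
  have fin: "finite \<Lambda>" and \<Lambda>F: "\<Lambda> \<subseteq> fin_words A F"
    using W by (auto simp: witnesses_irreducibility_def)
  have "cylinder A E \<mu> \<noteq> {}" if "\<mu> \<in> \<Lambda>" for \<mu>
  proof -
    have "\<mu> \<in> words A F (length \<mu>)"
      using that \<Lambda>F by (auto simp: fin_words_def words_def)
    then show ?thesis
      using cylinder_nonempty[OF W _ F(1)] cylinder_mono[OF FE] by blast
  qed
  with H fin \<open>\<Lambda> \<noteq> {}\<close> have \<kappa>: "?\<kappa> > 0" by (intro kappa_pos)
  have len: "length \<mu> \<le> ?q" if "\<mu> \<in> \<Lambda>" for \<mu>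
    using that fin by (simp add: max_length_def)
  note conv = pressure_converges[OF F]
  have Zfin: "Z m < \<infinity>" for m using conv(2)[of m] by (simp add: Z_def partition_function_eq)
  have bound: "?c * ?W \<le> ennreal (real (card \<Lambda>) * exp (t * real (n + ?q)))" if t: "t > p" for t
  proof -
    define M where "M = (SUP N\<in>{1..}. Z N * ennreal (exp (- t * real N)))"
    have "pressure A F f < ereal t" using P t by simp
    from order_tendstoD(2)[OF conv(1) this]
    obtain N0 where N0: "\<And>N. N \<ge> N0 \<Longrightarrow> ereal (1 / real N) * elog (Z N) < ereal t"
      by (auto simp: eventually_sequentially Z_def partition_function_eq)
    have "M \<le> 1 + (\<Sum>N<N0. Z N * ennreal (exp (- t * real N)))"
      unfolding M_def
    proof (rule SUP_least)
      fix N :: nat assume N: "N \<in> {1..}"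
      show "Z N * ennreal (exp (- t * real N)) \<le> 1 + (\<Sum>N<N0. Z N * ennreal (exp (- t * real N)))"
      proof (cases "N < N0")
        case True
        then have "Z N * ennreal (exp (- t * real N)) \<le> (\<Sum>N<N0. Z N * ennreal (exp (- t * real N)))"
          by (intro member_le_sum[where f = "\<lambda>N. Z N * ennreal (exp (- t * real N))"]) auto
        then show ?thesis by (rule order_trans) simp
      next
        case False
        then have "ereal (1 / real N) * elog (Z N) \<le> ereal t" using N0[of N] by simp
        then have "elog (Z N) \<le> ereal (t * real N)"
          using N by (cases "elog (Z N)") (auto simp: field_simps)
        then have "Z N \<le> ennreal (exp (t * real N))" by (rule elog_le_ereal)
        then have "Z N * ennreal (exp (- t * real N)) \<le> ennreal (exp (t * real N)) * ennreal (exp (- t * real N))"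
          by (intro mult_right_mono) auto
        also have "\<dots> = 1" by (simp flip: ennreal_mult exp_add)
        finally show ?thesis by (rule order_trans) simp
      qed
    qed
    also have "\<dots> < \<infinity>"
      using Zfin by (simp add: ennreal_mult_less_top)
    finally have Mfin: "M < \<infinity>" .
    have "0 < Z 1 * ennreal (exp (- t * real 1))"
      using relative_partition_pos[OF F(1), of f 1] by (simp add: Z_def ennreal_zero_less_mult_iff)
    also have "\<dots> \<le> M" unfolding M_def by (rule SUP_upper) simp
    finally have Mpos: "M > 0" .
    have step: "(?c * ?W) * (Z N * ennreal (exp (- t * real N)))
        \<le> ennreal (real (card \<Lambda>) * exp (t * real (n + ?q))) * M" if N: "N \<in> {1..}" for N
    proof -
      have "(?c * ?W) * (Z N * ennreal (exp (- t * real N)))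
          = (?c * (?W * Z N)) * ennreal (exp (- t * real N))"
        by (simp add: mult_ac)
      also have "\<dots> \<le> (\<Sum>\<mu>\<in>\<Lambda>. Z (n + length \<mu> + N)) * ennreal (exp (- t * real N))"
        unfolding Z_def using relative_partition_join_le[OF H FE W, of N n] N \<kappa>
        by (intro mult_right_mono) auto
      also have "\<dots> = (\<Sum>\<mu>\<in>\<Lambda>. Z (n + length \<mu> + N) * ennreal (exp (- t * real N)))"
        by (simp add: sum_distrib_right)
      also have "\<dots> \<le> (\<Sum>\<mu>\<in>\<Lambda>. ennreal (exp (t * real (n + ?q))) * M)"
      proof (rule sum_mono)
        fix \<mu> assume \<mu>: "\<mu> \<in> \<Lambda>"
        let ?m = "n + length \<mu>"
        have "exp (- t * real N) = exp (t * real ?m) * exp (- t * real (?m + N))"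
          by (simp add: algebra_simps flip: exp_add)
        then have "Z (?m + N) * ennreal (exp (- t * real N))
            = ennreal (exp (t * real ?m)) * (Z (?m + N) * ennreal (exp (- t * real (?m + N))))"
          by (simp only: ennreal_mult exp_ge_zero mult_ac)
        also have "\<dots> \<le> ennreal (exp (t * real (n + ?q))) * M"
        proof (rule mult_mono)
          show "ennreal (exp (t * real ?m)) \<le> ennreal (exp (t * real (n + ?q)))"
            using len[OF \<mu>] t P by (intro ennreal_leI) (auto intro!: mult_left_mono)
          show "Z (?m + N) * ennreal (exp (- t * real (?m + N))) \<le> M"
            unfolding M_def using N by (intro SUP_upper) auto
        qed auto
        finally show "Z (?m + N) * ennreal (exp (- t * real N)) \<le> ennreal (exp (t * real (n + ?q))) * M" .
      qed
      also have "\<dots> = ennreal (real (card \<Lambda>) * exp (t * real (n + ?q))) * M"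
        by (simp add: ennreal_mult mult.assoc flip: ennreal_of_nat_eq_real_of_nat)
      finally show ?thesis .
    qed
    have "(?c * ?W) * M = (SUP N\<in>{1..}. (?c * ?W) * (Z N * ennreal (exp (- t * real N))))"
      unfolding M_def by (rule SUP_mult_left_ennreal)
    also have "\<dots> \<le> ennreal (real (card \<Lambda>) * exp (t * real (n + ?q))) * M"
      by (intro SUP_least step)
    finally have "(?c * ?W) * M \<le> ennreal (real (card \<Lambda>) * exp (t * real (n + ?q))) * M" .
    then show ?thesis
      using Mpos Mfin by (simp add: ennreal_mult_le_mult_iff mult.commute[of _ M])
  qed
  have "((\<lambda>t. ennreal (real (card \<Lambda>) * exp (t * real (n + ?q))))
      \<longlongrightarrow> ennreal (real (card \<Lambda>) * exp (p * real (n + ?q)))) (at_right p)"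
    by (intro tendsto_intros)
  then have "?c * ?W \<le> ennreal (real (card \<Lambda>) * exp (p * real (n + ?q)))"
  proof (rule tendsto_lowerbound)
    show "\<forall>\<^sub>F t in at_right p. ?c * ?W \<le> ennreal (real (card \<Lambda>) * exp (t * real (n + ?q)))"
      using eventually_at_right_less[of p] by (rule eventually_mono) (rule bound)
  qed simp
  then have "ennreal (exp ?L / ?\<kappa>) * (?c * ?W)
      \<le> ennreal (exp ?L / ?\<kappa>) * ennreal (real (card \<Lambda>) * exp (p * real (n + ?q)))"
    by (rule mult_left_mono) simp
  moreover have "ennreal (exp ?L / ?\<kappa>) * ?c = 1"
    using \<kappa> by (simp add: exp_minus flip: ennreal_mult)
  ultimately have "?W \<le> ennreal (exp ?L / ?\<kappa>) * ennreal (real (card \<Lambda>) * exp (p * real (n + ?q)))"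
    by (metis mult.assoc mult_1)
  also have "\<dots> = ennreal (exp ?L / ?\<kappa> * (real (card \<Lambda>) * exp (p * real (n + ?q))))"
    by (rule ennreal_mult''[symmetric]) simp
  also have "exp ?L / ?\<kappa> * (real (card \<Lambda>) * exp (p * real (n + ?q)))
      = real (card \<Lambda>) * exp ?L / ?\<kappa> * exp (real ?q * p) * exp p ^ n"
    by (simp add: algebra_simps exp_add flip: exp_of_nat_mult)
  finally show ?thesis .
qed

text \<open>
  Without this, \<open>lim\<close> in the definition of the pressure might not be a limit when the first
  partition function is infinite.
\<close>

lemma partition_function_infinite:
  assumes H: "Holder A E \<alpha> f" "\<alpha> > 0" and FE: "F \<subseteq> E"
    and W: "witnesses_irreducibility A F \<Lambda>" and ne: "inf_words A F \<noteq> {}"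
    and inf: "partition_function A F f 1 = \<infinity>" and n: "n \<ge> 1"
  shows "partition_function A F f n = \<infinity>"
proof -
  from ne obtain x where x: "x \<in> inf_words A F" by blast
  let ?L = "distortion A E f"
  have fin: "finite \<Lambda>" using W by (simp add: witnesses_irreducibility_def)
  define m where "m = Min (insert 0 ((\<lambda>\<mu>. birkhoff_sum f (n - 1) (\<mu> @- x)) ` \<Lambda>))"
  have "\<exists>\<mu>\<in>\<Lambda>. \<omega> @- \<mu> @- x \<in> inf_words A F" if "\<omega> \<in> words A F 1" for \<omega>
    using connecting_word[OF W that shd_in_alphabet[OF x]] x by blast
  then obtain g where g: "\<And>\<omega>. \<omega> \<in> words A F 1 \<Longrightarrow> g \<omega> \<in> \<Lambda>"
    "\<And>\<omega>. \<omega> \<in> words A F 1 \<Longrightarrow> \<omega> @- g \<omega> @- x \<in> inf_words A F"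
    by metis
  define z where "z \<omega> = \<omega> @- g \<omega> @- x" for \<omega>
  define h where "h \<omega> = stake n (z \<omega>)" for \<omega>
  have take1: "take 1 (h \<omega>) = \<omega>" if "\<omega> \<in> words A F 1" for \<omega>
    using that n by (simp add: h_def z_def take_stake words_def stake_shift)
  have weight: "ennreal (exp (m - ?L)) * cylinder_weight A F f \<omega> \<le> cylinder_weight A F f (h \<omega>)"
    if \<omega>: "\<omega> \<in> words A F 1" for \<omega>
  proof -
    have len: "length \<omega> = 1" using \<omega> by (simp add: words_def)
    have z: "z \<omega> \<in> inf_words A F" using g(2)[OF \<omega>] by (simp add: z_def)
    have "z \<omega> \<in> cylinder A E \<omega>"
      using z inf_words_mono[OF FE] by (auto simp: cylinder_def z_def stake_shift)
    then have "cylinder_weight A E f \<omega> \<le> ennreal (exp (f (z \<omega>) + ?L))"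
      using cylinder_weight_distortion[OF H] len by fastforce
    then have "cylinder_weight A F f \<omega> \<le> ennreal (exp (f (z \<omega>) + ?L))"
      using cylinder_weight_mono[OF FE] order_trans by blast
    then have "ennreal (exp (m - ?L)) * cylinder_weight A F f \<omega>
        \<le> ennreal (exp (m - ?L)) * ennreal (exp (f (z \<omega>) + ?L))"
      by (rule mult_left_mono) simp
    also have "\<dots> = ennreal (exp (f (z \<omega>) + m))"
      by (simp add: algebra_simps flip: ennreal_mult exp_add)
    also have "\<dots> \<le> ennreal (exp (birkhoff_sum f n (z \<omega>)))"
    proof -
      have "m \<le> birkhoff_sum f (n - 1) (g \<omega> @- x)"
        unfolding m_def using fin g(1)[OF \<omega>] by (intro Min_le) auto
      moreover have "birkhoff_sum f n (z \<omega>) = f (z \<omega>) + birkhoff_sum f (n - 1) (sdrop 1 (z \<omega>))"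
        using birkhoff_sum_add[of f 1 "n - 1"] n by simp
      moreover have "sdrop 1 (z \<omega>) = g \<omega> @- x"
        using len sdrop_shift[of 1 \<omega>] by (simp add: z_def)
      ultimately show ?thesis by (intro ennreal_leI) simp
    qed
    also have "\<dots> \<le> cylinder_weight A F f (h \<omega>)"
      using cylinder_weight_lower[of "z \<omega>" A F "h \<omega>" f] z by (simp add: h_def cylinder_def)
    finally show ?thesis .
  qed
  have "ennreal (exp (m - ?L)) * partition_function A F f 1
      = (\<Sum>\<^sub>\<infinity>\<omega>\<in>words A F 1. ennreal (exp (m - ?L)) * cylinder_weight A F f \<omega>)"
    by (simp add: partition_function_eq relative_partition_def infsum_ennreal_cmult)
  also have "\<dots> \<le> (\<Sum>\<^sub>\<infinity>\<omega>\<in>words A F 1. cylinder_weight A F f (h \<omega>))"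
    by (intro infsum_ennreal_mono weight)
  also have "\<dots> \<le> partition_function A F f n"
    unfolding partition_function_eq relative_partition_def
  proof (rule infsum_ennreal_inj_le)
    show "inj_on h (words A F 1)" by (rule inj_onI) (metis take1)
    show "h ` words A F 1 \<subseteq> words A F n"
      using g(2) by (auto simp: h_def z_def intro!: stake_in_words)
  qed
  finally show ?thesis
    using inf by (simp add: ennreal_mult_top top_unique)
qed

lemma first_occurrence_decomposition:
  assumes "\<omega> \<in> words A (insert a F) n"
  shows "\<omega> \<in> words A F n \<or>
    (\<exists>k<n. \<exists>\<rho>\<in>words A F k. \<exists>\<tau>\<in>words A (insert a F) (n - Suc k). \<omega> = \<rho> @ [a] @ \<tau>)"
proof (cases "a \<in> set \<omega>")
  case True
  then obtain \<rho> \<tau> where \<omega>: "\<omega> = \<rho> @ a # \<tau>" "a \<notin> set \<rho>" by (meson split_list_first)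
  with assms have "length \<rho> < n" "\<rho> \<in> words A F (length \<rho>)"
    "\<tau> \<in> words A (insert a F) (n - Suc (length \<rho>))" "\<omega> = \<rho> @ [a] @ \<tau>"
    by (auto simp: words_iff_successively successively_append_iff successively_Cons)
  then show ?thesis by blast
next
  case False
  with assms show ?thesis by (auto simp: words_def)
qed

lemma relative_partition_insert_le:
  "relative_partition A (insert a F) E f n \<le> relative_partition A F E f n
    + (\<Sum>k<n. relative_partition A F E f k * cylinder_weight A E f [a]
        * relative_partition A (insert a F) E f (n - Suc k))"
proof -
  define h where "h p = fst p @ [a] @ snd p" for p :: "'a list \<times> 'a list"
  define D where "D k = h ` (words A F k \<times> words A (insert a F) (n - Suc k))" for k
  let ?w = "cylinder_weight A E f"
  have "words A (insert a F) n \<subseteq> words A F n \<union> (\<Union>k\<in>{..<n}. D k)"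
  proof
    fix \<omega> assume "\<omega> \<in> words A (insert a F) n"
    from first_occurrence_decomposition[OF this] show "\<omega> \<in> words A F n \<union> (\<Union>k\<in>{..<n}. D k)"
      by (force simp: D_def h_def)
  qed
  then have "relative_partition A (insert a F) E f n \<le> infsum ?w (words A F n \<union> (\<Union>k\<in>{..<n}. D k))"
    unfolding relative_partition_def by (rule infsum_ennreal_subset)
  also have "\<dots> \<le> infsum ?w (words A F n) + infsum ?w (\<Union>k\<in>{..<n}. D k)"
    by (rule infsum_ennreal_Un_le)
  also have "\<dots> \<le> infsum ?w (words A F n) + (\<Sum>k\<in>{..<n}. infsum ?w (D k))"
    by (intro add_left_mono infsum_ennreal_UN_le) auto
  also have "\<dots> \<le> relative_partition A F E f n
    + (\<Sum>k<n. relative_partition A F E f k * ?w [a] * relative_partition A (insert a F) E f (n - Suc k))"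
    unfolding relative_partition_def[of A F E f n]
  proof (intro add_left_mono sum_mono)
    fix k
    have "infsum ?w (D k) \<le> (\<Sum>\<^sub>\<infinity>p\<in>words A F k \<times> words A (insert a F) (n - Suc k). ?w (h p))"
      unfolding D_def by (rule infsum_ennreal_image_le)
    also have "\<dots> \<le> (\<Sum>\<^sub>\<infinity>p\<in>words A F k \<times> words A (insert a F) (n - Suc k).
        ?w [a] * (case p of (\<rho>, \<tau>) \<Rightarrow> ?w \<rho> * ?w \<tau>))"
    proof (rule infsum_ennreal_mono)
      fix p :: "'a list \<times> 'a list"
      have "?w (h p) \<le> ?w (fst p) * ?w ([a] @ snd p)"
        unfolding h_def by (rule cylinder_weight_append_le)
      also have "\<dots> \<le> ?w (fst p) * (?w [a] * ?w (snd p))"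
        by (intro mult_left_mono cylinder_weight_append_le) auto
      finally show "?w (h p) \<le> ?w [a] * (case p of (\<rho>, \<tau>) \<Rightarrow> ?w \<rho> * ?w \<tau>)"
        by (simp add: case_prod_unfold mult_ac)
    qed
    also have "\<dots> = relative_partition A F E f k * ?w [a] * relative_partition A (insert a F) E f (n - Suc k)"
      by (simp add: infsum_ennreal_cmult infsum_ennreal_product relative_partition_def mult_ac)
    finally show "infsum ?w (D k)
      \<le> relative_partition A F E f k * ?w [a] * relative_partition A (insert a F) E f (n - Suc k)" .
  qed
  finally show ?thesis .
qed

lemma power_add_telescope:
  fixes x b :: "'b :: comm_semiring_1"
  shows "x ^ n + b * (\<Sum>k<n. x ^ k * (x + b) ^ (n - Suc k)) = (x + b) ^ n"
proof (induction n)
  case (Suc n)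
  have "(\<Sum>k<n. x ^ k * (x + b) ^ (Suc n - Suc k)) = (x + b) * (\<Sum>k<n. x ^ k * (x + b) ^ (n - Suc k))"
    unfolding sum_distrib_left
  proof (rule sum.cong)
    fix k assume "k \<in> {..<n}"
    then have "Suc n - Suc k = Suc (n - Suc k)" by auto
    then show "x ^ k * (x + b) ^ (Suc n - Suc k) = (x + b) * (x ^ k * (x + b) ^ (n - Suc k))"
      by (simp only: power_Suc mult_ac)
  qed simp
  then have "x ^ Suc n + b * (\<Sum>k<Suc n. x ^ k * (x + b) ^ (Suc n - Suc k))
      = x ^ Suc n + b * ((x + b) * (\<Sum>k<n. x ^ k * (x + b) ^ (n - Suc k)) + x ^ n)"
    by simp
  also have "\<dots> = (x + b) * (x ^ n + b * (\<Sum>k<n. x ^ k * (x + b) ^ (n - Suc k)))"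
    by (simp add: algebra_simps)
  finally show ?case by (simp add: Suc)
qed simp

lemma renewal_inequality_bound:
  fixes V U :: "nat \<Rightarrow> ennreal"
  assumes V: "\<And>n. V n \<le> U n + (\<Sum>k<n. U k * s * V (n - Suc k))"
    and U: "\<And>n. U n \<le> K * x ^ n"
  shows "V n \<le> K * (x + K * s) ^ n"
proof (induction n rule: less_induct)
  case (less n)
  let ?y = "x + K * s"
  have "V n \<le> U n + (\<Sum>k<n. U k * s * V (n - Suc k))" by (rule V)
  also have "\<dots> \<le> K * x ^ n + (\<Sum>k<n. (K * x ^ k) * s * (K * ?y ^ (n - Suc k)))"
    using less by (intro add_mono sum_mono mult_mono U) auto
  also have "\<dots> = K * (x ^ n + (K * s) * (\<Sum>k<n. x ^ k * ?y ^ (n - Suc k)))"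
    by (simp add: distrib_left sum_distrib_left mult_ac)
  also have "\<dots> = K * ?y ^ n" by (simp only: power_add_telescope)
  finally show ?case .
qed

theorem proposition2p6:
  fixes E F :: "'a set" and A :: "'a \<Rightarrow> 'a \<Rightarrow> nat" and \<Lambda> :: "'a list set"
    and \<alpha> :: real and a :: 'a and f :: "'a stream \<Rightarrow> real"
  assumes "countable E" and "infinite E"
    and "\<forall>i\<in>E. \<forall>j\<in>E. A i j \<in> {0, 1}"
    and "finitely_irreducible A E"
    and "F \<subseteq> E" and "finitely_irreducible A F"
    and "\<Lambda> \<noteq> {}" and "witnesses_irreducibility A F \<Lambda>"
    and "\<alpha> > 0"
    and "a \<in> E"
    and "Holder A E \<alpha> f"
    and "pressure A F f \<ge> 0"
  shows "eexp (pressure A (F \<union> {a}) f)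
    \<le> eexp (pressure A F f)
       + ennreal (real (card \<Lambda>) * exp (distortion A E f) / kappa A E \<Lambda> f)
         * eexp (ereal (real (max_length \<Lambda>)) * pressure A F f)
         * eexp (SUP \<tau>\<in>cylinder A E [a]. ereal (f \<tau>))"
proof -
  have ne: "inf_words A F \<noteq> {}"
    using pressure_no_inf_words[of A F f] \<open>pressure A F f \<ge> 0\<close> by auto
  consider "pressure A F f = \<infinity>" | p where "pressure A F f = ereal p" "p \<ge> 0"
    using \<open>pressure A F f \<ge> 0\<close> by (cases "pressure A F f") auto
  then show ?thesis
  proof cases
    case 1
    then show ?thesis by (simp add: eexp_def)
  next
    case P: 2
    let ?G = "insert a F"
    have "partition_function A F f 1 \<noteq> \<infinity>"
      using pressure_infinite_partition[of A F f]
        partition_function_infinite[OF \<open>Holder A E \<alpha> f\<close> \<open>\<alpha> > 0\<close> \<open>F \<subseteq> E\<close> assms(8) ne] P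
      by auto
    then have Z1: "partition_function A F f 1 < \<infinity>" by (simp add: less_top)
    define s where "s = eexp (SUP \<tau>\<in>cylinder A E [a]. ereal (f \<tau>))"
    have s: "cylinder_weight A E f [a] = s"
      by (simp add: s_def cylinder_weight_def eexp_SUP)
    define k where "k = real (card \<Lambda>) * exp (distortion A E f) / kappa A E \<Lambda> f
      * exp (real (max_length \<Lambda>) * p)"
    define x where "x = ennreal (exp p)"
    define y where "y = x + ennreal k * s"
    have "ennreal k = ennreal (real (card \<Lambda>) * exp (distortion A E f) / kappa A E \<Lambda> f)
        * ennreal (exp (real (max_length \<Lambda>) * p))"
      unfolding k_def by (rule ennreal_mult'') simp
    then have rhs: "eexp (pressure A F f)
       + ennreal (real (card \<Lambda>) * exp (distortion A E f) / kappa A E \<Lambda> f)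
         * eexp (ereal (real (max_length \<Lambda>)) * pressure A F f) * s = y"
      by (simp add: P(1) y_def x_def)
    note growth = relative_partition_growth[OF \<open>Holder A E \<alpha> f\<close> \<open>\<alpha> > 0\<close> \<open>F \<subseteq> E\<close> assms(8)
        \<open>\<Lambda> \<noteq> {}\<close> ne Z1 P, folded k_def]
    have U: "relative_partition A F E f n \<le> ennreal k * x ^ n" for n
      using growth[of n] by (simp add: x_def ennreal_mult'' ennreal_power)
    have V: "relative_partition A ?G E f n \<le> ennreal k * y ^ n" for n
      unfolding y_def using relative_partition_insert_le[of A a F E f, unfolded s] U
      by (rule renewal_inequality_bound)
    show ?thesis
    proof (cases "y = \<infinity>")
      case True
      then show ?thesis unfolding rhs[unfolded s_def] by simp
    next
      case False
      have GE: "?G \<subseteq> E" using \<open>F \<subseteq> E\<close> \<open>a \<in> E\<close> by blast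
      have Z: "partition_function A ?G f n \<le> ennreal k * y ^ n" for n
      proof -
        have "partition_function A ?G f n \<le> relative_partition A ?G E f n"
          unfolding partition_function_eq relative_partition_def
          by (intro infsum_ennreal_mono cylinder_weight_mono GE)
        then show ?thesis using V[of n] by (rule order_trans)
      qed
      have neG: "inf_words A ?G \<noteq> {}" using ne inf_words_mono[of F ?G A] by blast
      have "ennreal k * y ^ 1 < \<infinity>" using False by (simp add: ennreal_mult_less_top less_top)
      with Z[of 1] have "partition_function A ?G f 1 < \<infinity>" by (rule le_less_trans)
      note conv = pressure_converges(1)[OF neG this]
      obtain r where r: "y = ennreal r" "r \<ge> 0" using False by (cases y) auto
      have "ennreal (exp p) \<le> ennreal r" using r by (simp add: y_def x_def flip: r(1))
      then have "exp p \<le> r" using r by (simp add: ennreal_le_iff)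
      then have "r > 0" using exp_gt_zero[of p] by linarith
      have "inf_words A E \<noteq> {}" using ne inf_words_mono[OF \<open>F \<subseteq> E\<close>] by blast
      then have "1 \<le> ennreal k" using U[of 0] relative_partition_0[of A E F f] by simp
      then have "k > 0" by (cases "k > 0") (auto simp: ennreal_neg not_less)
      have "ereal (1 / real n) * elog (partition_function A ?G f n) \<le> ereal (ln k / real n + ln r)"
        if "n \<ge> 1" for n
      proof -
        have "elog (partition_function A ?G f n) \<le> elog (ennreal k * y ^ n)"
          by (rule elog_mono[OF Z])
        also have "ennreal k * y ^ n = ennreal (exp (ln k + real n * ln r))"
          using r \<open>r > 0\<close> \<open>k > 0\<close> by (simp add: ennreal_mult'' ennreal_power exp_add exp_of_nat_mult)
        finally have "elog (partition_function A ?G f n) \<le> ereal (ln k + real n * ln r)" by simp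
        then have "ereal (1 / real n) * elog (partition_function A ?G f n)
            \<le> ereal (1 / real n) * ereal (ln k + real n * ln r)"
          by (rule ereal_mult_left_mono) simp
        also have "\<dots> = ereal (ln k / real n + ln r)" using that by (simp add: field_simps)
        finally show ?thesis .
      qed
      then have "\<exists>N. \<forall>n\<ge>N. ereal (1 / real n) * elog (partition_function A ?G f n)
          \<le> ereal (ln k / real n + ln r)"
        by blast
      moreover have "(\<lambda>n. ln k / real n + ln r) \<longlonglongrightarrow> 0 + ln r"
        by (intro tendsto_add tendsto_const lim_const_over_n)
      then have "(\<lambda>n. ereal (ln k / real n + ln r)) \<longlonglongrightarrow> ereal (ln r)" by simp
      ultimately have "pressure A ?G f \<le> ereal (ln r)"
        using LIMSEQ_le[OF conv] by blast
      then have "eexp (pressure A ?G f) \<le> eexp (ereal (ln r))" by (rule eexp_mono)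
      also have "\<dots> = y" using r \<open>r > 0\<close> by simp
      finally show ?thesis using rhs by (simp add: s_def)
    qed
  qed
qed

end
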